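(* Let $X$ be a non-empty compact Hausdorff space with a countable base, let $\mathbf{I}$ be a completely codense ideal on $X$, and let $f:X\to X$ be a continuous and open map. Then $f$ is $\mathbf{I}$-transitive if and only if $\Omega_{\mathbf{I}}(f)=X$ and $f$ has an $\mathbf{I}$-dense (respectively, $*$-dense) orbit.
   Context: $f^n$ is the $n$-th iterate of $f$. An ideal on $X$ is a nonempty collection $\mathbf{I}\subseteq 2^X$ closed under taking subsets and finite unions. A set $A\subseteq X$ is preopen if $A\subseteq Int(Cl(A))$; the ideal $\mathbf{I}$ is completely codense if the only preopen set belonging to $\mathbf{I}$ is $\varnothing$. $f$ is $\mathbf{I}$-transitive if for every pair of non-empty open sets $A,B\subseteq X$ there is a positive integer $n$ with $f^n(A)\cap B\notin\mathbf{I}$. A point $x\in X$ is $\mathbf{I}$-non-wandering if for every neighbourhood $M$ of $x$ there is a positive integer $n$ with $f^n(M)\cap M\notin\mathbf{I}$; $\Omega_{\mathbf{I}}(f)$ is the set of all $\mathbf{I}$-non-wandering points. For $A\subseteq X$, the local function is $A^*=\{x\in X: U\cap A\notin\mathbf{I}\text{ for every open }U\ni x\}$, and $Cl^*(A)=A\cup A^*$; $A$ is $\mathbf{I}$-dense if $A^*=X$ and $*$-dense if $Cl^*(A)=X$. The orbit of $x\in X$ is $\{x,f(x),f^2(x),\dots\}$; $f$ has an $\mathbf{I}$-dense (respectively, $*$-dense) orbit if there is a point $x\in X$ whose orbit is $\mathbf{I}$-dense (respectively, $*$-dense). "Respectively" means that the equivalence is asserted in both versions. *)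

theory Defs
  imports "HOL-Analysis.Analysis"
begin

text \<open>Spaces are explicit topologies \<open>X\<close> with carrier \<open>topspace X\<close>; the behaviour of a
  self-map outside the carrier is irrelevant.  Ideals need not be proper.\<close>

definition ideal_on :: "'a set \<Rightarrow> 'a set set \<Rightarrow> bool" where
  "ideal_on S I \<longleftrightarrow>
     I \<subseteq> Pow S \<and> I \<noteq> {} \<and>
     (\<forall>A\<in>I. \<forall>B. B \<subseteq> A \<longrightarrow> B \<in> I) \<and>
     (\<forall>A\<in>I. \<forall>B\<in>I. A \<union> B \<in> I)"

definition preopen_in :: "'a topology \<Rightarrow> 'a set \<Rightarrow> bool" where
  "preopen_in X A \<longleftrightarrow> A \<subseteq> topspace X \<and> A \<subseteq> X interior_of (X closure_of A)"

definition completely_codense :: "'a topology \<Rightarrow> 'a set set \<Rightarrow> bool" where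
  "completely_codense X I \<longleftrightarrow> {A. preopen_in X A \<and> A \<in> I} = {{}}"

definition ideal_transitive :: "'a topology \<Rightarrow> 'a set set \<Rightarrow> ('a \<Rightarrow> 'a) \<Rightarrow> bool" where
  "ideal_transitive X I f \<longleftrightarrow>
     (\<forall>A B. openin X A \<and> A \<noteq> {} \<and> openin X B \<and> B \<noteq> {} \<longrightarrow>
        (\<exists>n>0. (f ^^ n) ` A \<inter> B \<notin> I))"

text \<open>Neighbourhoods of a point are not required to be open.\<close>

definition ideal_nonwandering :: "'a topology \<Rightarrow> 'a set set \<Rightarrow> ('a \<Rightarrow> 'a) \<Rightarrow> 'a set" where
  "ideal_nonwandering X I f =
     {x \<in> topspace X. \<forall>M. M \<subseteq> topspace X \<and> x \<in> X interior_of M \<longrightarrow>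
        (\<exists>n>0. (f ^^ n) ` M \<inter> M \<notin> I)}"

definition local_function :: "'a topology \<Rightarrow> 'a set set \<Rightarrow> 'a set \<Rightarrow> 'a set" where
  "local_function X I A =
     {x \<in> topspace X. \<forall>U. openin X U \<and> x \<in> U \<longrightarrow> U \<inter> A \<notin> I}"

definition star_closure :: "'a topology \<Rightarrow> 'a set set \<Rightarrow> 'a set \<Rightarrow> 'a set" where
  "star_closure X I A = A \<union> local_function X I A"

definition ideal_dense :: "'a topology \<Rightarrow> 'a set set \<Rightarrow> 'a set \<Rightarrow> bool" where
  "ideal_dense X I A \<longleftrightarrow> local_function X I A = topspace X"

definition star_dense :: "'a topology \<Rightarrow> 'a set set \<Rightarrow> 'a set \<Rightarrow> bool" where
  "star_dense X I A \<longleftrightarrow> star_closure X I A = topspace X"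

definition forward_orbit :: "('a \<Rightarrow> 'a) \<Rightarrow> 'a \<Rightarrow> 'a set" where
  "forward_orbit f x = range (\<lambda>n. (f ^^ n) x)"

definition has_ideal_dense_orbit :: "'a topology \<Rightarrow> 'a set set \<Rightarrow> ('a \<Rightarrow> 'a) \<Rightarrow> bool" where
  "has_ideal_dense_orbit X I f \<longleftrightarrow> (\<exists>x\<in>topspace X. ideal_dense X I (forward_orbit f x))"

definition has_star_dense_orbit :: "'a topology \<Rightarrow> 'a set set \<Rightarrow> ('a \<Rightarrow> 'a) \<Rightarrow> bool" where
  "has_star_dense_orbit X I f \<longleftrightarrow> (\<exists>x\<in>topspace X. star_dense X I (forward_orbit f x))"

end

theory Submission
  imports Defs
begin

text \<open>
  A completely codense ideal cannot see the difference between ``not in the ideal'' and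
  ``non-empty'' on the sets that matter here. A dense subset of a non-empty open set is preopen,
  so it never belongs to the ideal (\<open>openin_Int_dense_notin_ideal\<close>). This removes the ideal from
  all notions involved: since \<open>f\<close> is open, the sets \<open>f\<^sup>n(A) \<inter> B\<close> with \<open>A\<close> and \<open>B\<close> open are
  open, so transitivity and non-wandering modulo the ideal are the usual topological properties
  (\<open>ideal_transitive_iff\<close>, \<open>ideal_nonwandering_eq_topspace_iff\<close>), and being dense modulo the
  ideal or \<open>*\<close>-dense is ordinary density (\<open>ideal_dense_iff_dense\<close>, \<open>star_dense_iff_dense\<close>).

  What remains is classical topological dynamics. A transitive map has a dense orbit by Baire's
  theorem: for each non-empty basic open \<open>V\<close>, the points whose orbit enters \<open>V\<close> form a dense open set
  (\<open>transitive_imp_dense_orbit\<close>). Conversely, a dense orbit visits \<open>A\<close> at some time \<open>i\<close>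
  and \<open>B\<close> at some time \<open>j\<close>. If \<open>i < j\<close>, then \<open>A\<close> reaches \<open>B\<close>. Otherwise the points of
  \<open>B\<close> that lie in \<open>A\<close> after \<open>i - j\<close> steps form a non-empty open set; when every point is
  non-wandering, this set returns to itself after more than \<open>i - j\<close> steps
  (\<open>late_return\<close>), and so \<open>A\<close> reaches \<open>B\<close> again
  (\<open>dense_orbit_nonwandering_imp_transitive\<close>).
\<close>

section \<open>Completely codense ideals and density\<close>

text \<open>
  The set \<open>U \<inter> D\<close> is dense in \<open>U\<close>, hence contained in the interior of its closure: it is a
  non-empty preopen set.
\<close>

lemma openin_Int_dense_notin_ideal:
  assumes cod: "completely_codense X I"
    and D: "X closure_of D = topspace X"
    and U: "openin X U" "U \<noteq> {}"
  shows "U \<inter> D \<notin> I"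
proof
  assume "U \<inter> D \<in> I"
  have eq: "X closure_of (U \<inter> D) = X closure_of U"
    using D U(1) by (simp add: closure_of_openin_Int_superset openin_subset)
  have sub: "U \<subseteq> X interior_of (X closure_of U)"
    using U(1) by (simp add: closure_of_subset interior_of_maximal openin_subset)
  have "preopen_in X (U \<inter> D)"
    unfolding preopen_in_def eq using sub openin_subset[OF U(1)] by (simp add: le_infI1)
  with \<open>U \<inter> D \<in> I\<close> have "U \<inter> D \<in> {A. preopen_in X A \<and> A \<in> I}"
    by simp
  then have "D \<inter> U = {}"
    unfolding cod[unfolded completely_codense_def] by blast
  then show False
    using D U by (simp add: dense_intersects_open)
qed

lemma openin_notin_ideal_iff:
  assumes "completely_codense X I" "openin X U"
  shows "U \<notin> I \<longleftrightarrow> U \<noteq> {}"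
proof
  show "U \<noteq> {}" if "U \<notin> I"
    using that assms(1) by (auto simp: completely_codense_def)
  show "U \<notin> I" if "U \<noteq> {}"
    using openin_Int_dense_notin_ideal[OF assms(1) closure_of_topspace assms(2) that]
    by (simp add: openin_subset[OF assms(2)] inf.absorb1)
qed

lemma ideal_dense_iff_dense:
  assumes cod: "completely_codense X I"
  shows "ideal_dense X I D \<longleftrightarrow> X closure_of D = topspace X"
proof
  assume L: "ideal_dense X I D"
  have "D \<inter> U \<noteq> {}" if U: "openin X U" "U \<noteq> {}" for U
  proof -
    obtain x where "x \<in> U" "x \<in> topspace X"
      using U openin_subset by blast
    then have "U \<inter> D \<notin> I"
      using L U(1) by (auto simp: ideal_dense_def local_function_def)
    moreover have "{} \<in> I"
      using cod by (auto simp: completely_codense_def)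
    ultimately show ?thesis
      by (metis Int_commute)
  qed
  then show "X closure_of D = topspace X"
    by (simp add: dense_intersects_open)
next
  assume "X closure_of D = topspace X"
  then have "U \<inter> D \<notin> I" if "openin X U" "x \<in> U" for x U
    using that openin_Int_dense_notin_ideal[OF cod] by (metis empty_iff)
  then show "ideal_dense X I D"
    by (auto simp: ideal_dense_def local_function_def)
qed

text \<open>
  An open set missing \<open>D\<close> misses the local function of \<open>D\<close> as well, because the empty set lies in the
  ideal; so \<open>*\<close>-density is squeezed between density modulo the ideal and ordinary density.
\<close>

lemma star_dense_iff_dense:
  assumes cod: "completely_codense X I" and D: "D \<subseteq> topspace X"
  shows "star_dense X I D \<longleftrightarrow> X closure_of D = topspace X"
proof
  assume *: "star_dense X I D"
  have "{} \<in> I"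
    using cod by (auto simp: completely_codense_def)
  have "D \<inter> U \<noteq> {}" if U: "openin X U" "U \<noteq> {}" for U
  proof -
    obtain x where x: "x \<in> U" "x \<in> topspace X"
      using U(2) openin_subset[OF U(1)] by auto
    have "x \<in> D \<union> local_function X I D"
      using * x(2) by (simp add: star_dense_def star_closure_def)
    then show ?thesis
    proof
      assume "x \<in> D"
      with x(1) show ?thesis by blast
    next
      assume "x \<in> local_function X I D"
      with U(1) x(1) have "U \<inter> D \<notin> I"
        by (simp add: local_function_def)
      with \<open>{} \<in> I\<close> show ?thesis
        by (metis Int_commute)
    qed
  qed
  then show "X closure_of D = topspace X"
    by (simp add: dense_intersects_open)
next
  assume "X closure_of D = topspace X"
  then show "star_dense X I D"
    using ideal_dense_iff_dense[OF cod, of D] D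
    unfolding ideal_dense_def star_dense_def star_closure_def by auto
qed

section \<open>Transitivity and non-wandering points without the ideal\<close>

lemma continuous_map_funpow:
  assumes "continuous_map X X f"
  shows "continuous_map X X (f ^^ n)"
proof (induction n)
  case (Suc n)
  then show ?case
    using continuous_map_compose[OF Suc.IH assms] by (simp only: funpow.simps)
qed (simp add: id_def)

lemma open_map_funpow:
  assumes "open_map X X f"
  shows "open_map X X (f ^^ n)"
proof (induction n)
  case (Suc n)
  then show ?case
    using open_map_compose[OF Suc.IH assms] by (simp only: funpow.simps)
qed (simp add: open_map_def)

lemma ideal_transitive_iff:
  assumes cod: "completely_codense X I" and f: "open_map X X f"
  shows "ideal_transitive X I f \<longleftrightarrow>
    (\<forall>A B. openin X A \<and> A \<noteq> {} \<and> openin X B \<and> B \<noteq> {} \<longrightarrow>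
       (\<exists>n>0. (f ^^ n) ` A \<inter> B \<noteq> {}))"
proof -
  have "(f ^^ n) ` A \<inter> B \<notin> I \<longleftrightarrow> (f ^^ n) ` A \<inter> B \<noteq> {}" if "openin X A" "openin X B" for n A B
    using that open_map_funpow[OF f] openin_notin_ideal_iff[OF cod]
    unfolding open_map_def by (meson openin_Int)
  then show ?thesis
    unfolding ideal_transitive_def by meson
qed

text \<open>
  An arbitrary neighbourhood \<open>M\<close> inherits the return of its interior, because ideals are closed
  under subsets.
\<close>

lemma ideal_nonwandering_eq_topspace_iff:
  assumes I: "ideal_on (topspace X) I"
    and cod: "completely_codense X I" and f: "open_map X X f"
  shows "ideal_nonwandering X I f = topspace X \<longleftrightarrow>
    (\<forall>U. openin X U \<and> U \<noteq> {} \<longrightarrow> (\<exists>n>0. (f ^^ n) ` U \<inter> U \<noteq> {}))"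
    (is "?lhs \<longleftrightarrow> ?rhs")
proof -
  have eq: "(f ^^ n) ` U \<inter> U \<notin> I \<longleftrightarrow> (f ^^ n) ` U \<inter> U \<noteq> {}" if "openin X U" for n U
    using that open_map_funpow[OF f] openin_notin_ideal_iff[OF cod]
    unfolding open_map_def by (meson openin_Int)
  show ?thesis
  proof
    assume L: ?lhs
    show ?rhs
    proof (intro allI impI)
      fix U assume U: "openin X U \<and> U \<noteq> {}"
      then obtain x where "x \<in> U" "x \<in> topspace X"
        using openin_subset by blast
      then have "\<exists>n>0. (f ^^ n) ` U \<inter> U \<notin> I"
        using L U openin_subset[of X U] interior_of_openin[of X U]
        unfolding ideal_nonwandering_def by blast
      then show "\<exists>n>0. (f ^^ n) ` U \<inter> U \<noteq> {}"
        using U eq by blast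
    qed
  next
    assume R: ?rhs
    have "\<exists>n>0. (f ^^ n) ` M \<inter> M \<notin> I" if "x \<in> X interior_of M" for x M
    proof -
      let ?U = "X interior_of M"
      have "openin X ?U \<and> ?U \<noteq> {}"
        using that by auto
      then obtain n where n: "n > 0" "(f ^^ n) ` ?U \<inter> ?U \<noteq> {}"
        using R by meson
      then have "(f ^^ n) ` ?U \<inter> ?U \<notin> I"
        using eq[OF openin_interior_of] by simp
      moreover have "(f ^^ n) ` ?U \<inter> ?U \<subseteq> (f ^^ n) ` M \<inter> M"
        using interior_of_subset[of X M] by (intro Int_mono image_mono)
      ultimately have "(f ^^ n) ` M \<inter> M \<notin> I"
        using I unfolding ideal_on_def by metis
      with n(1) show ?thesis by meson
    qed
    then show ?lhs
      by (auto simp: ideal_nonwandering_def)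
  qed
qed

section \<open>Transitivity and dense orbits\<close>

text \<open>
  For \<open>V\<close> open and non-empty, the points whose orbit meets \<open>V\<close> form an open set \<open>G V\<close>, and
  \<open>G V\<close> is dense by transitivity. By Baire's theorem some point lies in \<open>G V\<close> for
  all the countably many non-empty basic sets \<open>V\<close>, so its orbit meets every non-empty open set.
\<close>

lemma transitive_imp_dense_orbit:
  assumes ne: "topspace X \<noteq> {}"
    and X: "locally_compact_space X" "regular_space X" "second_countable X"
    and f: "continuous_map X X f"
    and trans: "\<And>A B. \<lbrakk>openin X A; A \<noteq> {}; openin X B; B \<noteq> {}\<rbrakk> \<Longrightarrow>
      \<exists>n. (f ^^ n) ` A \<inter> B \<noteq> {}"
  obtains x where "x \<in> topspace X" "X closure_of forward_orbit f x = topspace X"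
proof -
  obtain \<B> where \<B>: "countable \<B>" "\<And>V. V \<in> \<B> \<Longrightarrow> openin X V"
    and base: "\<And>U x. \<lbrakk>openin X U; x \<in> U\<rbrakk> \<Longrightarrow> \<exists>V\<in>\<B>. x \<in> V \<and> V \<subseteq> U"
    using X(3) unfolding second_countable_def by metis
  define G where "G V = (\<Union>n. {x \<in> topspace X. (f ^^ n) x \<in> V})" for V
  have "openin X (G V) \<and> X closure_of (G V) = topspace X" if V: "openin X V" "V \<noteq> {}" for V
  proof
    show "openin X (G V)"
      unfolding G_def
      using openin_continuous_map_preimage[OF continuous_map_funpow[OF f] V(1)] by auto
    have "G V \<inter> U \<noteq> {}" if U: "openin X U" "U \<noteq> {}" for U
    proof -
      obtain n x where "x \<in> U" "(f ^^ n) x \<in> V"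
        using trans[OF U V] by blast
      then show ?thesis
        using openin_subset[OF U(1)] unfolding G_def by blast
    qed
    then show "X closure_of (G V) = topspace X"
      by (simp add: dense_intersects_open)
  qed
  then have "X closure_of \<Inter>(G ` (\<B> - {{}})) = topspace X"
    using \<B> X by (intro Baire_category) auto
  then have "\<Inter>(G ` (\<B> - {{}})) \<inter> topspace X \<noteq> {}"
    using ne by (simp add: dense_intersects_open)
  then obtain x where x: "x \<in> topspace X" "\<And>V. \<lbrakk>V \<in> \<B>; V \<noteq> {}\<rbrakk> \<Longrightarrow> x \<in> G V"
    by auto
  have "forward_orbit f x \<inter> U \<noteq> {}" if U: "openin X U" "U \<noteq> {}" for U
  proof -
    obtain V where "V \<in> \<B>" "V \<noteq> {}" "V \<subseteq> U"
      using U base by blast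
    then show ?thesis
      using x(2)[of V] unfolding G_def forward_orbit_def by blast
  qed
  then have "X closure_of forward_orbit f x = topspace X"
    by (simp add: dense_intersects_open)
  with x(1) show thesis by (rule that)
qed

text \<open>
  If \<open>U\<close> returns to itself at time \<open>n\<close>, then the points of \<open>U\<close> that do so form a non-empty open
  set, and a return of that smaller set at time \<open>m > 0\<close> is a return of \<open>U\<close> at time \<open>m + n\<close>.
\<close>

lemma late_return:
  assumes f: "continuous_map X X f"
    and nw: "\<And>U. \<lbrakk>openin X U; U \<noteq> {}\<rbrakk> \<Longrightarrow> \<exists>n>0. (f ^^ n) ` U \<inter> U \<noteq> {}"
    and U: "openin X U" "U \<noteq> {}"
  shows "\<exists>n>k. (f ^^ n) ` U \<inter> U \<noteq> {}"
proof (induction k)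
  case 0
  show ?case using nw[OF U] .
next
  case (Suc k)
  then obtain n where n: "n > k" "(f ^^ n) ` U \<inter> U \<noteq> {}"
    by blast
  define W where "W = {x \<in> U. (f ^^ n) x \<in> U}"
  have "openin X W"
    unfolding W_def
    using openin_continuous_map_preimage_gen[OF continuous_map_funpow[OF f] U(1) U(1)] .
  moreover have "W \<noteq> {}"
    using n(2) unfolding W_def by blast
  ultimately obtain m z where m: "m > 0" and z: "z \<in> W" "(f ^^ m) z \<in> W"
    using nw[of W] by blast
  have "(f ^^ (n + m)) z \<in> U"
    using z(2) unfolding W_def by (simp add: funpow_add)
  moreover have "z \<in> U"
    using z(1) unfolding W_def by blast
  ultimately have "(f ^^ (n + m)) ` U \<inter> U \<noteq> {}"
    by blast
  moreover have "n + m > Suc k"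
    using n(1) m by simp
  ultimately show ?case by blast
qed

text \<open>
  The delicate case is when the orbit visits \<open>B\<close> at time \<open>j\<close> and \<open>A\<close> only later (or at the
  same time), at time \<open>i = j + d\<close>. The set \<open>W\<close> of points of \<open>B\<close> that are in \<open>A\<close> after \<open>d\<close>
  steps returns to itself at some time \<open>n > d\<close>; between the times \<open>d\<close> and \<open>n\<close> a returning point
  travels from \<open>A\<close> to \<open>B\<close>. An arbitrary return time would not do: the return to \<open>B\<close> has to come
  after the visit to \<open>A\<close>.
\<close>

lemma dense_orbit_nonwandering_imp_transitive:
  assumes f: "continuous_map X X f"
    and nw: "\<And>U. \<lbrakk>openin X U; U \<noteq> {}\<rbrakk> \<Longrightarrow> \<exists>n>0. (f ^^ n) ` U \<inter> U \<noteq> {}"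
    and dense: "X closure_of forward_orbit f x = topspace X"
    and A: "openin X A" "A \<noteq> {}" and B: "openin X B" "B \<noteq> {}"
  shows "\<exists>n>0. (f ^^ n) ` A \<inter> B \<noteq> {}"
proof -
  obtain i where i: "(f ^^ i) x \<in> A"
    using dense A unfolding dense_intersects_open forward_orbit_def by blast
  obtain j where j: "(f ^^ j) x \<in> B"
    using dense B unfolding dense_intersects_open forward_orbit_def by blast
  show ?thesis
  proof (cases "i < j")
    case True
    then have "(f ^^ (j - i)) ((f ^^ i) x) = (f ^^ j) x"
      by (metis comp_apply funpow_add le_add_diff_inverse2 less_imp_le)
    with i j have "(f ^^ (j - i)) ` A \<inter> B \<noteq> {}"
      by (metis IntI empty_iff imageI)
    with True show ?thesis
      by (meson zero_less_diff)
  next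
    case False
    define d where "d = i - j"
    define W where "W = {y \<in> B. (f ^^ d) y \<in> A}"
    have "openin X W"
      unfolding W_def
      using openin_continuous_map_preimage_gen[OF continuous_map_funpow[OF f] B(1) A(1)] .
    moreover have "(f ^^ d) ((f ^^ j) x) = (f ^^ i) x"
      using False unfolding d_def by (metis comp_apply funpow_add le_add_diff_inverse2 not_less)
    then have "(f ^^ j) x \<in> W"
      using i j unfolding W_def by simp
    ultimately obtain n z where n: "n > d" and z: "z \<in> W" "(f ^^ n) z \<in> W"
      using late_return[OF f nw, of W d] by blast
    have "(f ^^ (n - d)) ((f ^^ d) z) = (f ^^ n) z"
      using n by (metis comp_apply funpow_add le_add_diff_inverse2 less_imp_le)
    then have "(f ^^ (n - d)) ((f ^^ d) z) \<in> B" "(f ^^ d) z \<in> A"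
      using z unfolding W_def by auto
    with n show ?thesis
      by (intro exI[of _ "n - d"]) auto
  qed
qed

theorem proposition5p3:
  fixes X :: "'a topology" and I :: "'a set set" and f :: "'a \<Rightarrow> 'a"
  assumes "topspace X \<noteq> {}"
    and "compact_space X" and "Hausdorff_space X" and "second_countable X"
    and "ideal_on (topspace X) I" and "completely_codense X I"
    and "continuous_map X X f" and "open_map X X f"
  shows "(ideal_transitive X I f \<longleftrightarrow>
            ideal_nonwandering X I f = topspace X \<and> has_ideal_dense_orbit X I f) \<and>
         (ideal_transitive X I f \<longleftrightarrow>
            ideal_nonwandering X I f = topspace X \<and> has_star_dense_orbit X I f)"
proof -
  note trans = ideal_transitive_iff[OF assms(6,8)]
  note nw = ideal_nonwandering_eq_topspace_iff[OF assms(5,6,8)]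
  let ?D = "\<exists>x\<in>topspace X. X closure_of forward_orbit f x = topspace X"
  have orbit: "forward_orbit f x \<subseteq> topspace X" if "x \<in> topspace X" for x
    using that continuous_map_funspace[OF continuous_map_funpow[OF assms(7)]]
    unfolding forward_orbit_def by auto
  have star: "has_star_dense_orbit X I f \<longleftrightarrow> ?D"
    unfolding has_star_dense_orbit_def
    by (intro bex_cong refl star_dense_iff_dense[OF assms(6)] orbit)
  have idl: "has_ideal_dense_orbit X I f \<longleftrightarrow> ?D"
    by (simp add: has_ideal_dense_orbit_def ideal_dense_iff_dense[OF assms(6)])
  have "ideal_transitive X I f \<longleftrightarrow> ideal_nonwandering X I f = topspace X \<and> ?D"
  proof
    assume T: "ideal_transitive X I f"
    have "locally_compact_space X" "regular_space X"
      using assms(2,3) compact_imp_locally_compact_space compact_Hausdorff_imp_regular_space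
      by blast+
    then obtain x where "x \<in> topspace X" "X closure_of forward_orbit f x = topspace X"
      by (rule transitive_imp_dense_orbit[OF assms(1) _ _ assms(4,7)])
        (use T[unfolded trans] in meson)
    then have ?D ..
    moreover have "ideal_nonwandering X I f = topspace X"
      using T unfolding trans nw by meson
    ultimately show "ideal_nonwandering X I f = topspace X \<and> ?D" by blast
  next
    assume R: "ideal_nonwandering X I f = topspace X \<and> ?D"
    then obtain x where x: "X closure_of forward_orbit f x = topspace X"
      by (elim conjE bexE)
    have returns: "\<exists>n>0. (f ^^ n) ` U \<inter> U \<noteq> {}" if "openin X U" "U \<noteq> {}" for U
      using R[unfolded nw] that by simp
    show "ideal_transitive X I f"
      unfolding trans
      using dense_orbit_nonwandering_imp_transitive[OF assms(7) returns x] by simp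
  qed
  then show ?thesis
    by (simp only: star idl)
qed

end
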